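(* Let the matrix $P_j$ with entries $\{p_{m,n}\}_{m,n=1}^N$ be defined by $$p_{m,n}=\begin{cases}1 & \text{if } m=n,\\ 1 & \text{if } n=\big((m+j-1)\bmod N\big)+1,\\ 0 & \text{otherwise.}\end{cases}$$ Then the following holds: (1) The entries of $P_j^{k+1}$, which are denoted by $\{p_{m,n}(j,k)\}_{m,n=1}^N$, are given by $$p_{m,n}(j,k)=\begin{cases}\binom{k+1}{\ell} & \text{if } n=\big((m+j\ell-1)\bmod N\big)+1,\\ 0 & \text{otherwise,}\end{cases}$$ where it is implied that $\ell$ is an integer satisfying $0\le\ell\le k+1$. (2) $\Phi_{k,2^j}$ has the decomposition $$\Phi_{k,2^j}=P_j^{k+1}P_{j-1}^{k+1}\cdots P_1^{k+1}\,\Phi_k,$$ and therefore $$\Phi_{k,2^j}=P_j^{k+1}\,\Phi_{k,2^{j-1}}.$$ (3) The equality $\Phi_{k,2^j}=P_j^{k+1}P_{j-1}^{k+1}\cdots P_1^{k+1}\,\Phi_k$ holds for any rearrangement of the product of matrices.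
   Context: Here $N$, $k$ (the order) and $j$ are positive integers, $P_i$ for $1\le i\le j$ is the matrix defined in the claim with $i$ in place of $j$, and $x\bmod N\in\{0,\dots,N-1\}$ denotes the remainder of $x$ modulo $N$. The discrete convolution of $f,g\in\mathbb{R}^N$ is $(f*g)_m=\sum_{n=0}^{N-1}f_n\,g_{m-n}$ for $m=0,\dots,N-1$, where $g$ is extended $N$-periodically. The periodic $k$-th order finite difference of $f\in\mathbb{R}^N$ is $f*\phi_k$, where $\phi_k\in\mathbb{R}^N$ is defined by $$(\phi_k)_m=\begin{cases}(-1)^k & \text{if } m=0,\\ 0 & \text{if } 1\le m<N-k,\\ (-1)^{k+m+N}\binom{k}{N-m} & \text{if } N-k\le m<N.\end{cases}$$ For a positive integer scale $s$, the periodic $k$-th order finite difference of scale $s$ of $f\in\mathbb{R}^N$ is $f*\phi_{k,s}$, where $\phi_{k,s}\in\mathbb{R}^N$ is defined by $$(\phi_{k,s})_m=\begin{cases}(-1)^k & \text{if } m=0,\\ 0 & \text{if } 1\le m\le N-s(k+1),\\ (-1)^{k+\lfloor\frac{N-m}{s}\rfloor}\binom{k}{\lfloor\frac{N-m}{s}\rfloor} & \text{if } N-s(k+1)<m<N.\end{cases}$$ $\Phi_k$ and $\Phi_{k,s}$ are the $N\times N$ circulant matrices representing these convolutions, i.e. $\Phi_kf=f*\phi_k$ and $\Phi_{k,s}f=f*\phi_{k,s}$ for all $f\in\mathbb{R}^N$. In particular $\Phi_{k,1}=\Phi_k$. For example, the first row of $\Phi_2$ is $(1,-2,1,0,\dots,0)$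 and the first row of $\Phi_{2,2}$ is $(1,1,-2,-2,1,1,0,\dots,0)$.
   Formalization: In (2),(3) the i-th factor shifts by 2^{i-1}, not i (same for i=1,2; as printed false for j≥3), and 2^j(k+1)≤N is assumed (fails e.g. N=2, k=j=1); (1) assumes jℓ mod N distinct for 0≤ℓ≤k+1, else the formula is ambiguous or false. *)

theory Defs
  imports "Jordan_Normal_Form.Matrix"
begin

definition periodic :: "real vec \<Rightarrow> int \<Rightarrow> real" where
  "periodic g i = g $ nat (i mod int (dim_vec g))"

definition conv :: "real vec \<Rightarrow> real vec \<Rightarrow> real vec" where
  "conv f g = vec (dim_vec f)
     (\<lambda>m. \<Sum>n<dim_vec f. f $ n * periodic g (int m - int n))"

definition circulant :: "real vec \<Rightarrow> real mat" where
  "circulant g = mat (dim_vec g) (dim_vec g)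
     (\<lambda>(m, n). periodic g (int m - int n))"

text \<open>The inequalities are written additively, so that truncated subtraction on
  naturals plays no role even if the stencil is longer than the signal.\<close>

definition phi :: "nat \<Rightarrow> nat \<Rightarrow> real vec" where
  "phi N k = vec N (\<lambda>m.
     if m = 0 then (-1) ^ k
     else if m + k < N then 0
     else (-1) ^ (k + m + N) * real (k choose (N - m)))"

definition phi_scale :: "nat \<Rightarrow> nat \<Rightarrow> nat \<Rightarrow> real vec" where
  "phi_scale N k s = vec N (\<lambda>m.
     if m = 0 then (-1) ^ k
     else if m + s * (k + 1) \<le> N then 0
     else (-1) ^ (k + (N - m) div s) * real (k choose ((N - m) div s)))"

definition Phi :: "nat \<Rightarrow> nat \<Rightarrow> real mat" where
  "Phi N k = circulant (phi N k)"

definition Phi_scale :: "nat \<Rightarrow> nat \<Rightarrow> nat \<Rightarrow> real mat" where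
  "Phi_scale N k s = circulant (phi_scale N k s)"

text \<open>Library matrices are indexed from 0; \<open>m\<close> and \<open>n\<close> below are the
  indices running from 1 to \<open>N\<close>.\<close>

definition P_mat :: "nat \<Rightarrow> nat \<Rightarrow> real mat" where
  "P_mat N j = mat N N (\<lambda>(r, c). let m = r + 1; n = c + 1 in
     if m = n then 1
     else if n = ((m + j - 1) mod N) + 1 then 1
     else 0)"

definition mat_prod :: "nat \<Rightarrow> real mat list \<Rightarrow> real mat" where
  "mat_prod N Ms = foldr (*) Ms (1\<^sub>m N)"

text \<open>The list of the matrices \<open>P^(k+1)\<close> at levels \<open>j, j - 1, \<dots>, 1\<close>, followed by
  \<open>Phi N k\<close>. The matrix at level \<open>i\<close> shifts by \<open>2^(i-1)\<close>: with \<open>S\<close> the cyclic shift,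
  \<open>Phi N k = (-1)^k (1 - S)^k\<close> and
  \<open>Phi_scale N k s = (-1)^k (1 - S^s)^k (1 + S + \<dots> + S^(s-1))\<close> when \<open>s (k + 1) \<le> N\<close>,
  so that passing from scale \<open>2^(i-1)\<close> to scale \<open>2^i\<close> is multiplication by
  \<open>(1 + S^(2^(i-1)))^(k+1)\<close>. A shift by \<open>i\<close> itself would agree with this only for
  \<open>i = 1\<close> and \<open>i = 2\<close>.\<close>

definition factors :: "nat \<Rightarrow> nat \<Rightarrow> nat \<Rightarrow> real mat list" where
  "factors N k j =
     map (\<lambda>i. P_mat N (2 ^ (i - 1)) ^\<^sub>m (k + 1)) (rev [1..<j + 1]) @ [Phi N k]"

lemma circulant_carrier: "g \<in> carrier_vec N \<Longrightarrow> circulant g \<in> carrier_mat N N"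
  by (auto simp: circulant_def)

lemma circulant_mult_vec:
  assumes "g \<in> carrier_vec N" "f \<in> carrier_vec N"
  shows "circulant g *\<^sub>v f = conv f g"
  using assms
  by (intro eq_vecI)
     (auto simp: circulant_def conv_def scalar_prod_def mult.commute
       atLeast0LessThan intro!: sum.cong)

lemma circulant_unique:
  assumes g: "g \<in> carrier_vec N" and A: "A \<in> carrier_mat N N"
    and rep: "\<And>f. f \<in> carrier_vec N \<Longrightarrow> A *\<^sub>v f = conv f g"
  shows "A = circulant g"
proof (rule eq_matI)
  fix i j assume "i < dim_row (circulant g)" "j < dim_col (circulant g)"
  then have ij: "i < N" "j < N" using g by (auto simp: circulant_def)
  have C: "circulant g \<in> carrier_mat N N" by (rule circulant_carrier[OF g])
  have "A *\<^sub>v unit_vec N j = circulant g *\<^sub>v unit_vec N j"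
    by (simp add: rep circulant_mult_vec[OF g])
  then have "(A *\<^sub>v unit_vec N j) $ i = (circulant g *\<^sub>v unit_vec N j) $ i" by simp
  then show "A $$ (i, j) = circulant g $$ (i, j)"
    using A C ij by auto
qed (use A g in \<open>auto simp: circulant_def\<close>)

lemma Phi_mult_vec: "f \<in> carrier_vec N \<Longrightarrow> Phi N k *\<^sub>v f = conv f (phi N k)"
  unfolding Phi_def by (rule circulant_mult_vec) (auto simp: phi_def)

lemma Phi_scale_mult_vec:
  "f \<in> carrier_vec N \<Longrightarrow> Phi_scale N k s *\<^sub>v f = conv f (phi_scale N k s)"
  unfolding Phi_scale_def by (rule circulant_mult_vec) (auto simp: phi_scale_def)

lemma Phi_scale_1: "Phi_scale N k 1 = Phi N k"
proof -
  have "phi_scale N k 1 = phi N k"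
  proof (rule eq_vecI)
    fix m assume "m < dim_vec (phi N k)"
    then have m: "m < N" by (simp add: phi_def)
    have "(-1 :: real) ^ (k + m + N) = (-1) ^ (k + (N - m))"
    proof -
      have "k + m + N = (k + (N - m)) + 2 * m" using m by simp
      then show ?thesis by (simp only: power_add power_mult) simp
    qed
    then show "phi_scale N k 1 $ m = phi N k $ m"
      using m by (auto simp: phi_scale_def phi_def)
  qed (simp add: phi_scale_def phi_def)
  then show ?thesis by (simp add: Phi_scale_def Phi_def)
qed

end

theory Submission
  imports Defs "HOL-Computational_Algebra.Polynomial"
begin

text \<open>
  Let \<open>S\<close> be the cyclic shift of \<open>N\<close> points. All matrices in the theorem are polynomials in \<open>S\<close>,
  and \<open>p \<mapsto> p(S)\<close> is a ring homomorphism from a commutative ring, so every claim is the image of an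
  identity between polynomials:

  \<^item> \<open>P_mat N t\<close> is \<open>(1 + X^t)(S)\<close> as long as \<open>N\<close> does not divide \<open>t\<close>; the binomial theorem for
    \<open>(1 + X^t)^(k+1)\<close> gives the entries of its power, and the injectivity hypothesis says exactly
    that no two monomials \<open>X^(t l)\<close> end up on the same diagonal after wrapping around modulo \<open>N\<close>
    (\<open>index_P_mat_power\<close>).

  \<^item> \<open>Phi_scale N k s\<close> is \<open>D_s(S)\<close> for \<open>D_s = (X^s - 1)^k (1 + X + \<dots> + X^(s-1))\<close>: the last
    factor repeats every difference coefficient \<open>s\<close> times, and \<open>s (k + 1) \<le> N\<close> prevents overlap
    modulo \<open>N\<close> (\<open>Phi_scale_eq_shift_poly\<close>).

  \<^item> Since \<open>X^(2s) - 1 = (1 + X^s) (X^s - 1)\<close> and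
    \<open>1 + \<dots> + X^(2s-1) = (1 + X^s) (1 + \<dots> + X^(s-1))\<close>, one has
    \<open>D_(2s) = (1 + X^s)^(k+1) D_s\<close> (\<open>diff_poly_double\<close>). Iterating from \<open>s = 1\<close> yields
    the decomposition of \<open>Phi_scale N k (2 ^ j)\<close>.

  Independence of the order of the factors is the commutativity of polynomial multiplication.
\<close>

section \<open>Polynomials in the cyclic shift\<close>

text \<open>The entry \<open>(m, n)\<close> of \<open>p(S)\<close>, where \<open>S\<close> has its ones at the positions
  \<open>(m, m + 1)\<close> modulo \<open>N\<close>. The row \<open>m\<close> ranges
  over all naturals rather than residues, so that multiplication by \<open>X\<close> is the step from \<open>m\<close> to
  \<open>Suc m\<close> with no reduction modulo \<open>N\<close>.\<close>

definition wrap_coeff :: "nat \<Rightarrow> 'a::comm_semiring_1 poly \<Rightarrow> nat \<Rightarrow> nat \<Rightarrow> 'a" where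
  "wrap_coeff N p m n = (\<Sum>i\<le>degree p. if (m + i) mod N = n then coeff p i else 0)"

definition shift_poly :: "nat \<Rightarrow> 'a::comm_semiring_1 poly \<Rightarrow> 'a mat" where
  "shift_poly N p = mat N N (\<lambda>(m, n). wrap_coeff N p m n)"

lemma index_shift_poly:
  "m < N \<Longrightarrow> n < N \<Longrightarrow> shift_poly N p $$ (m, n) = wrap_coeff N p m n"
  by (simp add: shift_poly_def)

lemma wrap_coeff_bound:
  assumes "degree p \<le> D"
  shows "wrap_coeff N p m n = (\<Sum>i\<le>D. if (m + i) mod N = n then coeff p i else 0)"
  unfolding wrap_coeff_def
  by (rule sum.mono_neutral_left) (use assms in \<open>auto simp: coeff_eq_0\<close>)

lemma wrap_coeff_mod: "wrap_coeff N p (m mod N) n = wrap_coeff N p m n"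
  by (simp add: wrap_coeff_def mod_add_left_eq)

lemma wrap_coeff_0 [simp]: "wrap_coeff N 0 m n = 0"
  unfolding wrap_coeff_def by (rule sum.neutral) auto

lemma wrap_coeff_add: "wrap_coeff N (p + q) m n = wrap_coeff N p m n + wrap_coeff N q m n"
proof -
  let ?D = "max (degree p) (degree q)"
  have "degree (p + q) \<le> ?D" by (rule degree_add_le_max)
  then show ?thesis
    by (simp add: wrap_coeff_bound[where D = ?D] sum.distrib[symmetric] if_distrib
        cong: if_cong sum.cong)
qed

lemma wrap_coeff_smult: "wrap_coeff N (smult c p) m n = c * wrap_coeff N p m n"
  unfolding wrap_coeff_bound[OF degree_smult_le] wrap_coeff_def[of N p] sum_distrib_left
  by (intro sum.cong) auto

lemma wrap_coeff_pCons:
  "wrap_coeff N (pCons a p) m n = (if m mod N = n then a else 0) + wrap_coeff N p (Suc m) n"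
  by (simp add: wrap_coeff_bound[OF degree_pCons_le] wrap_coeff_def sum.atMost_Suc_shift
      del: sum.atMost_Suc cong: if_cong)

lemma wrap_coeff_monom: "wrap_coeff N (monom c i) m n = (if (m + i) mod N = n then c else 0)"
  by (induction i arbitrary: m) (auto simp: monom_0 monom_Suc wrap_coeff_pCons)

lemma wrap_coeff_sum: "wrap_coeff N (\<Sum>i\<in>A. f i) m n = (\<Sum>i\<in>A. wrap_coeff N (f i) m n)"
  by (induction A rule: infinite_finite_induct) (auto simp: wrap_coeff_add)

text \<open>Multiplicativity of \<open>p \<mapsto> p(S)\<close>, by Horner's rule: with \<open>p = a + X p'\<close>, the \<open>m\<close>-th row of \<open>p(S)\<close>
  is \<open>a\<close> times a unit vector plus the row \<open>m + 1\<close> of \<open>p'(S)\<close>.\<close>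

lemma wrap_coeff_mult:
  assumes "0 < N"
  shows "wrap_coeff N (p * q) m n = (\<Sum>r<N. wrap_coeff N p m r * wrap_coeff N q r n)"
proof (induction p arbitrary: m)
  case (pCons a p)
  have "(\<Sum>r<N. (if m mod N = r then a else 0) * wrap_coeff N q r n)
      = (\<Sum>r<N. if m mod N = r then a * wrap_coeff N q r n else 0)"
    by (intro sum.cong) auto
  also have "\<dots> = a * wrap_coeff N q m n"
    using assms by (simp add: sum.delta' wrap_coeff_mod)
  finally show ?case
    by (simp add: mult_pCons_left wrap_coeff_add wrap_coeff_smult wrap_coeff_pCons pCons.IH
        distrib_right sum.distrib)
qed simp

lemma shift_poly_mult:
  assumes "0 < N"
  shows "shift_poly N (p * q) = shift_poly N p * shift_poly N q"
  by (rule eq_matI)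
     (auto simp: shift_poly_def scalar_prod_def wrap_coeff_mult[OF assms] atLeast0LessThan)

lemma wrap_coeff_1: "wrap_coeff N 1 m n = (if m mod N = n then 1 else 0)"
  using wrap_coeff_monom[of N 1 0 m n] by (simp add: monom_eq_1)

lemma shift_poly_1: "shift_poly N 1 = 1\<^sub>m N"
  by (rule eq_matI) (auto simp: shift_poly_def wrap_coeff_1)

lemma shift_poly_power:
  assumes "0 < N"
  shows "shift_poly N (p ^ e) = shift_poly N p ^\<^sub>m e"
proof (induction e)
  case 0
  have "dim_row (shift_poly N p) = N"
    by (simp add: shift_poly_def)
  then show ?case by (simp add: shift_poly_1)
next
  case (Suc e)
  then show ?case by (simp only: power_Suc2 shift_poly_mult[OF assms] pow_mat.simps)
qed

lemma mat_prod_shift_poly: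
  assumes "0 < N"
  shows "mat_prod N (map (shift_poly N) ps) = shift_poly N (prod_list ps)"
  by (induction ps) (simp_all add: mat_prod_def shift_poly_1 shift_poly_mult[OF assms])

text \<open>The homomorphism need not be injective, but any choice of preimages turns the product of
  matrices into a product of polynomials, which only depends on the multiset of factors.\<close>

lemma mat_prod_shift_poly_permute:
  assumes "0 < N" and range: "set Ms \<subseteq> range (shift_poly N)" and perm: "mset Ms' = mset Ms"
  shows "mat_prod N Ms' = mat_prod N Ms"
proof -
  define g where "g = inv_into UNIV (shift_poly N :: real poly \<Rightarrow> real mat)"
  have *: "mat_prod N Xs = shift_poly N (\<Prod>p\<in>#image_mset g (mset Xs). p)"
    if "set Xs \<subseteq> range (shift_poly N)" for Xs
  proof -
    have "map (shift_poly N) (map g Xs) = Xs"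
      using that by (auto simp: g_def f_inv_into_f intro!: map_idI)
    then show ?thesis
      using mat_prod_shift_poly[OF \<open>0 < N\<close>, of "map g Xs"]
      by (simp flip: mset_map add: prod_mset_prod_list)
  qed
  show ?thesis
    using *[of Ms] *[of Ms'] range perm mset_eq_setD[OF perm] by simp
qed

section \<open>The matrices as polynomials in the shift\<close>

lemma mod_add_eq_add_iff:
  fixes a b m N :: nat
  shows "(m + a) mod N = (m + b) mod N \<longleftrightarrow> a mod N = b mod N"
  by (simp add: nat_mod_eq_iff add.assoc)

text \<open>If \<open>N\<close> divided \<open>t\<close>, both conditions in the definition of \<open>P_mat\<close> would hold on the diagonal
  and the polynomial would give \<open>2\<close> there instead of \<open>1\<close>.\<close>

lemma P_mat_eq_shift_poly:
  assumes "t mod N \<noteq> 0"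
  shows "P_mat N t = shift_poly N (1 + monom 1 t)"
proof (rule eq_matI)
  fix r c
  assume "r < dim_row (shift_poly N (1 + monom 1 t) :: real mat)"
    and "c < dim_col (shift_poly N (1 + monom 1 t) :: real mat)"
  then have rc: "r < N" "c < N" by (auto simp: shift_poly_def)
  have "(r + t) mod N \<noteq> r"
    using assms rc mod_add_eq_add_iff[of r t N 0] by simp
  then show "P_mat N t $$ (r, c) = shift_poly N (1 + monom 1 t) $$ (r, c)"
    using rc by (auto simp: P_mat_def index_shift_poly wrap_coeff_add wrap_coeff_monom
        wrap_coeff_1)
qed (simp_all add: P_mat_def shift_poly_def)

lemma index_P_mat_power:
  fixes N t e :: nat
  assumes "t mod N \<noteq> 0" and "r < N" and "c < N"
  shows "(P_mat N t ^\<^sub>m e) $$ (r, c)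
    = (\<Sum>l\<le>e. if (r + t * l) mod N = c then real (e choose l) else 0)"
proof -
  have "(1 + monom 1 t :: real poly) ^ e = (\<Sum>l\<le>e. monom (real (e choose l)) (t * l))"
    using binomial_ring[of "monom 1 t" "1 :: real poly" e]
    by (simp add: add.commute monom_power of_nat_monom mult_monom)
  then show ?thesis
    using assms
    by (simp add: P_mat_eq_shift_poly index_shift_poly wrap_coeff_sum wrap_coeff_monom
        flip: shift_poly_power)
qed

text \<open>The polynomial \<open>D_s\<close>: a \<open>k\<close>-fold difference with step \<open>s\<close>, smeared over blocks of \<open>s\<close>
  consecutive points. The factor \<open>X^s - 1\<close> rather than \<open>1 - X^s\<close> absorbs the global sign \<open>(-1)^k\<close>
  of the stencil.\<close>

definition diff_poly :: "nat \<Rightarrow> nat \<Rightarrow> real poly" where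
  "diff_poly k s = (monom 1 s - 1) ^ k * (\<Sum>i<s. monom 1 i)"

text \<open>Expanding the product writes every exponent below \<open>s (k + 1)\<close> uniquely as \<open>l s + i\<close> with
  \<open>i < s\<close>, which is where the quotient by \<open>s\<close> in the stencil comes from.\<close>

lemma diff_poly_expand:
  "diff_poly k s = (\<Sum>d<Suc k * s. monom ((-1) ^ (k + d div s) * real (k choose (d div s))) d)"
proof -
  \<comment> \<open>The constant is written as a monomial so that every power in the expansion is a monomial.\<close>
  have minus_one: "monom 1 s - 1 = monom 1 s + (monom (-1) 0 :: real poly)"
    by (simp add: monom_0 one_pCons)
  have "(monom 1 s - 1 :: real poly) ^ k
      = (\<Sum>l\<le>k. monom ((-1) ^ (k - l) * real (k choose l)) (l * s))"
    unfolding minus_one using binomial_ring[of "monom 1 s" "monom (-1) 0 :: real poly" k]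
    by (simp add: monom_power of_nat_monom mult_monom mult_ac)
  also have "\<dots> = (\<Sum>l<Suc k. monom ((-1) ^ (k + l) * real (k choose l)) (l * s))"
    unfolding lessThan_Suc_atMost by (rule sum.cong) (auto simp: minus_one_power_iff)
  finally have "diff_poly k s
      = (\<Sum>l<Suc k. \<Sum>i<s. monom ((-1) ^ (k + l) * real (k choose l)) (l * s + i))"
    by (simp only: diff_poly_def sum_product mult_monom mult_1_right)
  also have "\<dots> = (\<Sum>l<Suc k. \<Sum>d = l * s..<l * s + s.
      monom ((-1) ^ (k + d div s) * real (k choose (d div s))) d)"
  proof (rule sum.cong[OF refl])
    fix l
    show "(\<Sum>i<s. monom ((-1) ^ (k + l) * real (k choose l)) (l * s + i))
        = (\<Sum>d = l * s..<l * s + s. monom ((-1) ^ (k + d div s) * real (k choose (d div s))) d)"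
      by (rule sum.reindex_bij_witness[where i = "\<lambda>d. d - l * s" and j = "\<lambda>i. l * s + i"])
         (auto simp: div_add1_eq)
  qed
  also have "\<dots> = (\<Sum>d<Suc k * s. monom ((-1) ^ (k + d div s) * real (k choose (d div s))) d)"
    by (rule sum.nat_group)
  finally show ?thesis .
qed

text \<open>All three cases of the stencil are one formula in the distance \<open>d\<close> by which the column lies
  to the right of the row: \<open>d = 0\<close> gives the first case, and the binomial coefficient vanishes
  for \<open>s (k + 1) \<le> d\<close>.\<close>

lemma index_Phi_scale:
  assumes "0 < s" and "m < N" and "d < N"
  shows "Phi_scale N k s $$ (m, (m + d) mod N) = (-1) ^ (k + d div s) * real (k choose (d div s))"
proof -
  define e where "e = (if d = 0 then 0 else N - d)"
  have "(int m - int ((m + d) mod N)) mod int N = (- int d) mod int N"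
    by (simp add: zmod_int mod_diff_right_eq)
  also have "\<dots> = int e"
    using \<open>d < N\<close> by (auto simp: e_def zmod_zminus1_eq_if)
  finally have "Phi_scale N k s $$ (m, (m + d) mod N)
      = phi_scale N k s $ e"
    using assms by (simp add: Phi_scale_def circulant_def periodic_def phi_scale_def)
  also have "\<dots> = (-1) ^ (k + d div s) * real (k choose (d div s))"
  proof (cases "s * (k + 1) \<le> d")
    case True
    then have "k < d div s"
      using \<open>0 < s\<close> by (metis Suc_eq_plus1 Suc_le_eq less_eq_div_iff_mult_less_eq mult.commute)
    moreover have "0 < d" using True \<open>0 < s\<close> by (cases d) auto
    ultimately show ?thesis using True assms by (auto simp: e_def phi_scale_def)
  next
    case False
    then show ?thesis using assms by (auto simp: e_def phi_scale_def)
  qed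
  finally show ?thesis .
qed

text \<open>In general, wrapping around modulo \<open>N\<close> adds up the coefficients of \<open>D_s\<close> over each residue
  class, whereas the stencil \<open>phi_scale\<close> is simply cut off at length \<open>N\<close>. The two agree once
  the degree \<open>s (k + 1) - 1\<close> of \<open>D_s\<close> is below \<open>N\<close>.\<close>

lemma Phi_scale_eq_shift_poly:
  assumes "0 < s" and "s * (k + 1) \<le> N"
  shows "Phi_scale N k s = shift_poly N (diff_poly k s)"
proof (rule eq_matI)
  fix m n
  assume "m < dim_row (shift_poly N (diff_poly k s))" "n < dim_col (shift_poly N (diff_poly k s))"
  then have mn: "m < N" "n < N" by (auto simp: shift_poly_def)
  \<comment> \<open>The residue of \<open>n - m\<close>, with \<open>N\<close> added so that the difference stays nonnegative.\<close>
  define d where "d = (n + (N - m)) mod N"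
  have d: "d < N" "n = (m + d) mod N"
    using mn by (simp_all add: d_def mod_add_right_eq)
  let ?c = "\<lambda>d. (-1) ^ (k + d div s) * real (k choose (d div s))"
  have "wrap_coeff N (diff_poly k s) m n = (\<Sum>i<Suc k * s. if (m + i) mod N = n then ?c i else 0)"
    by (simp only: diff_poly_expand wrap_coeff_sum wrap_coeff_monom)
  \<comment> \<open>The exponents are all below \<open>N\<close>, so only \<open>d\<close> itself lands in column \<open>n\<close>.\<close>
  also have "\<dots> = (\<Sum>i<Suc k * s. if i = d then ?c i else 0)"
    using assms d by (intro sum.cong refl if_cong) (auto simp: mod_add_eq_add_iff mult.commute)
  also have "\<dots> = (if d < Suc k * s then ?c d else 0)"
    by simp
  also have "\<dots> = ?c d"
  proof -
    have "k < d div s" if "\<not> d < Suc k * s"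
      using that \<open>0 < s\<close> by (metis Suc_le_eq less_eq_div_iff_mult_less_eq not_less)
    then show ?thesis by auto
  qed
  finally show "Phi_scale N k s $$ (m, n) = shift_poly N (diff_poly k s) $$ (m, n)"
    using index_Phi_scale[OF \<open>0 < s\<close> \<open>m < N\<close> \<open>d < N\<close>, of k] d(2) mn
    by (simp add: index_shift_poly)
qed (simp_all add: Phi_scale_def circulant_def phi_scale_def shift_poly_def)

section \<open>Doubling the scale\<close>

lemma diff_poly_double: "diff_poly k (2 * s) = (1 + monom 1 s) ^ (k + 1) * diff_poly k s"
proof -
  let ?Y = "monom 1 s :: real poly"
  have "monom 1 (2 * s) = ?Y * ?Y"
    by (simp add: mult_monom mult_2)
  then have "monom 1 (2 * s) - 1 = (1 + ?Y) * (?Y - 1)"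
    by (simp add: algebra_simps)
  moreover have "(\<Sum>i<2 * s. monom 1 i) = (1 + ?Y) * (\<Sum>i<s. monom 1 i)"
  proof -
    have "(\<Sum>i<t. monom 1 i :: real poly) + (\<Sum>i<u. monom 1 (t + i)) = (\<Sum>i<t + u. monom 1 i)"
      for t u
      by (induction u) (simp_all add: add.assoc)
    from this[of s s]
    have "(\<Sum>i<2 * s. monom 1 i :: real poly) = (\<Sum>i<s. monom 1 i) + (\<Sum>i<s. monom 1 (s + i))"
      by (simp only: mult_2)
    also have "\<dots> = (1 + ?Y) * (\<Sum>i<s. monom 1 i)"
      unfolding distrib_right sum_distrib_left mult_monom by (simp add: sum.distrib)
    finally show ?thesis .
  qed
  ultimately show ?thesis
    by (simp add: diff_poly_def power_mult_distrib mult_ac)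
qed

lemma diff_poly_pow2:
  "diff_poly k (2 ^ j)
    = prod_list (map (\<lambda>i. (1 + monom 1 (2 ^ (i - 1))) ^ (k + 1)) (rev [1..<j + 1])) * diff_poly k 1"
proof (induction j)
  case (Suc j)
  have "diff_poly k (2 ^ Suc j) = (1 + monom 1 (2 ^ j)) ^ (k + 1) * diff_poly k (2 ^ j)"
    by (simp only: power_Suc diff_poly_double)
  then show ?case by (simp add: Suc.IH mult.assoc)
qed simp

text \<open>The bound on \<open>2 ^ j * (k + 1)\<close> serves twice: every shift \<open>2 ^ (i - 1)\<close> that occurs is nonzero modulo
  \<open>N\<close>, and the stencil of \<open>Phi N k\<close> does not wrap around.\<close>

lemma factors_eq_shift_poly:
  assumes "2 ^ j * (k + 1) \<le> N"
  shows "factors N k j = map (shift_poly N)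
    (map (\<lambda>i. (1 + monom 1 (2 ^ (i - 1))) ^ (k + 1)) (rev [1..<j + 1]) @ [diff_poly k 1])"
proof -
  have "2 ^ j * 1 \<le> 2 ^ j * (k + 1)" "1 * (k + 1) \<le> 2 ^ j * (k + 1)"
    by (rule mult_le_mono; simp)+
  from this[THEN order_trans, OF assms] have bounds: "2 ^ j \<le> N" "k + 1 \<le> N"
    by simp_all
  have "P_mat N (2 ^ (i - 1)) ^\<^sub>m (k + 1) = shift_poly N ((1 + monom 1 (2 ^ (i - 1))) ^ (k + 1))"
    if "i \<in> {1..j}" for i
  proof -
    have "(2::nat) ^ (i - 1) < 2 ^ j" using that by (intro power_strict_increasing) auto
    then have "2 ^ (i - 1) < N" using bounds by linarith
    then have "2 ^ (i - 1) mod N \<noteq> 0" by simp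
    moreover have "0 < N" using bounds by linarith
    ultimately show ?thesis
      by (simp add: P_mat_eq_shift_poly shift_poly_power del: pow_mat.simps power_Suc)
  qed
  moreover have "Phi N k = shift_poly N (diff_poly k 1)"
    using Phi_scale_eq_shift_poly[of 1 k N] bounds by (simp add: Phi_scale_1 del: One_nat_def)
  ultimately show ?thesis
    by (auto simp: factors_def)
qed

theorem theorem1:
  fixes N k j :: nat
  assumes "0 < N" and "0 < k" and "0 < j"
  shows
    "(inj_on (\<lambda>l. (j * l) mod N) {0..k + 1} \<longrightarrow>
       (\<forall>m\<in>{1..N}. \<forall>n\<in>{1..N}.
          (\<forall>l\<in>{0..k + 1}. n = ((m + j * l - 1) mod N) + 1 \<longrightarrow>
             (P_mat N j ^\<^sub>m (k + 1)) $$ (m - 1, n - 1) = real ((k + 1) choose l)) \<and>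
          ((\<forall>l\<in>{0..k + 1}. n \<noteq> ((m + j * l - 1) mod N) + 1) \<longrightarrow>
             (P_mat N j ^\<^sub>m (k + 1)) $$ (m - 1, n - 1) = 0)))
     \<and>
     (2 ^ j * (k + 1) \<le> N \<longrightarrow>
       Phi_scale N k (2 ^ j) = mat_prod N (factors N k j) \<and>
       Phi_scale N k (2 ^ j) =
         P_mat N (2 ^ (j - 1)) ^\<^sub>m (k + 1) * Phi_scale N k (2 ^ (j - 1)))
     \<and>
     (2 ^ j * (k + 1) \<le> N \<longrightarrow>
       (\<forall>Ms. mset Ms = mset (factors N k j) \<longrightarrow> Phi_scale N k (2 ^ j) = mat_prod N Ms))"
proof -
  have decomposition: "Phi_scale N k (2 ^ j) = mat_prod N (factors N k j)"
    if le: "2 ^ j * (k + 1) \<le> N"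
    using Phi_scale_eq_shift_poly[OF _ le]
    by (simp add: factors_eq_shift_poly[OF le] mat_prod_shift_poly[OF \<open>0 < N\<close>] diff_poly_pow2
        del: map_append upt_Suc)
  show ?thesis
  proof (intro conjI impI allI)
    assume inj: "inj_on (\<lambda>l. (j * l) mod N) {0..k + 1}"
    \<comment> \<open>The exponents for \<open>l = 0\<close> and \<open>l = 1\<close> differ modulo \<open>N\<close>.\<close>
    have j: "j mod N \<noteq> 0"
      using inj_onD[OF inj, of 0 1] by auto
    show "\<forall>m\<in>{1..N}. \<forall>n\<in>{1..N}.
            (\<forall>l\<in>{0..k + 1}. n = ((m + j * l - 1) mod N) + 1 \<longrightarrow>
               (P_mat N j ^\<^sub>m (k + 1)) $$ (m - 1, n - 1) = real ((k + 1) choose l)) \<and>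
            ((\<forall>l\<in>{0..k + 1}. n \<noteq> ((m + j * l - 1) mod N) + 1) \<longrightarrow>
               (P_mat N j ^\<^sub>m (k + 1)) $$ (m - 1, n - 1) = 0)"
    proof (intro ballI)
      fix m n assume "m \<in> {1..N}" "n \<in> {1..N}"
      then obtain r c where rc: "m = Suc r" "n = Suc c" "r < N" "c < N"
        by (cases m; cases n) auto
      have entry: "(P_mat N j ^\<^sub>m (k + 1)) $$ (m - 1, n - 1)
          = (\<Sum>l\<le>k + 1. if (r + j * l) mod N = c then real ((k + 1) choose l) else 0)"
        using index_P_mat_power[OF j rc(3,4), of "k + 1"] rc(1,2) by (simp only: diff_Suc_1)
      have "(P_mat N j ^\<^sub>m (k + 1)) $$ (m - 1, n - 1) = real ((k + 1) choose l)"
        if l: "l \<in> {0..k + 1}" "n = ((m + j * l - 1) mod N) + 1" for l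
      proof -
        have "(r + j * l') mod N = c \<longleftrightarrow> l' = l" if "l' \<le> k + 1" for l'
          using l rc that inj_on_eq_iff[OF inj, of l' l] by (auto simp: mod_add_eq_add_iff)
        then have "(P_mat N j ^\<^sub>m (k + 1)) $$ (m - 1, n - 1)
            = (\<Sum>l'\<le>k + 1. if l' = l then real ((k + 1) choose l') else 0)"
          unfolding entry by (intro sum.cong) auto
        then show ?thesis using l by simp
      qed
      moreover have "(P_mat N j ^\<^sub>m (k + 1)) $$ (m - 1, n - 1) = 0"
        if "\<forall>l\<in>{0..k + 1}. n \<noteq> ((m + j * l - 1) mod N) + 1"
        unfolding entry using that rc by (intro sum.neutral) auto
      ultimately show "(\<forall>l\<in>{0..k + 1}. n = ((m + j * l - 1) mod N) + 1 \<longrightarrow>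
               (P_mat N j ^\<^sub>m (k + 1)) $$ (m - 1, n - 1) = real ((k + 1) choose l)) \<and>
            ((\<forall>l\<in>{0..k + 1}. n \<noteq> ((m + j * l - 1) mod N) + 1) \<longrightarrow>
               (P_mat N j ^\<^sub>m (k + 1)) $$ (m - 1, n - 1) = 0)"
        by blast
    qed
  next
    assume le: "2 ^ j * (k + 1) \<le> N"
    show "Phi_scale N k (2 ^ j) = mat_prod N (factors N k j)"
      by (rule decomposition[OF le])
  next
    assume le: "2 ^ j * (k + 1) \<le> N"
    define s :: nat where "s = 2 ^ (j - 1)"
    have s: "0 < s" "2 ^ j = 2 * s"
      using \<open>0 < j\<close> by (simp_all add: s_def flip: power_Suc)
    have "s * (k + 1) + s * (k + 1) \<le> N"
      using le by (simp only: s mult_2 distrib_right)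
    moreover have "s \<le> s * (k + 1)" by simp
    ultimately have half: "s * (k + 1) \<le> N" and "s < N"
      using \<open>0 < s\<close> by linarith+
    have "s mod N \<noteq> 0" using s \<open>s < N\<close> by simp
    have "Phi_scale N k (2 ^ j) = shift_poly N (diff_poly k (2 * s))"
      using Phi_scale_eq_shift_poly[OF _ le] by (simp add: s)
    also have "\<dots> = P_mat N s ^\<^sub>m (k + 1) * Phi_scale N k s"
      by (simp only: diff_poly_double shift_poly_mult[OF \<open>0 < N\<close>] shift_poly_power[OF \<open>0 < N\<close>]
          P_mat_eq_shift_poly[OF \<open>s mod N \<noteq> 0\<close>] Phi_scale_eq_shift_poly[OF \<open>0 < s\<close> half])
    finally show "Phi_scale N k (2 ^ j) =
        P_mat N (2 ^ (j - 1)) ^\<^sub>m (k + 1) * Phi_scale N k (2 ^ (j - 1))"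
      by (simp only: s_def)
  next
    fix Ms
    assume le: "2 ^ j * (k + 1) \<le> N" and "mset Ms = mset (factors N k j)"
    then show "Phi_scale N k (2 ^ j) = mat_prod N Ms"
      unfolding decomposition[OF le]
      by (intro mat_prod_shift_poly_permute[OF \<open>0 < N\<close>, symmetric])
        (auto simp: factors_eq_shift_poly[OF le])
  qed
qed

end
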